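(* Let $R_0\in(0,+\infty]$ and let $\ell$ be as described in the context. Let $K:\mathbb{R}^d\times(\mathbb{R}^d\setminus\{0\})\to[0,+\infty)$ be a measurable function of the form $K(x,h)=k(h)$ (independent of $x$) with $K(x,h)=K(x,-h)$ for almost all $x,h$, such that for fixed constants $\kappa,K_0\ge1$ $$\kappa^{-1}|h|^{-d}\ell(|h|)\le K(x,h)\le\kappa|h|^{-d}\ell(|h|)\quad\text{for }0<|h|<R_0,\qquad \sup_{x\in\mathbb{R}^d}\int_{\mathbb{R}^d\setminus\{0\}}(1\wedge|h|^2)K(x,h)\,dh\le K_0.$$ Let $A$ be the operator defined on the Schwartz space $\mathcal{S}(\mathbb{R}^d)$ by $$Au(x)=\int_{\mathbb{R}^d\setminus\{0\}}\big(u(x+h)-u(x)-\langle\nabla u(x),h\rangle\mathbf{1}_{B_1}(h)\big)\,\nu(dh),\qquad \nu(dh)=k(h)\,dh,$$ let $\psi$ be the corresponding characteristic exponent, and set $L(r)=\int_r^{R_0}\ell(s)\frac{ds}{s}$. Then there are constants $c>0$ and $r_0>0$ such that $$c^{-1}L(|\xi|^{-1})\le\psi(\xi)\le c\,L(|\xi|^{-1})\quad\text{for }\xi\in\mathbb{R}^d,\ |\xi|\ge r_0.$$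
   Context: $B_1$ is the open unit ball of $\mathbb{R}^d$ centered at $0$. The characteristic exponent corresponding to the Lévy measure $\nu$ (with zero Gaussian part and zero drift) is $$\psi(\xi)=\int_{\mathbb{R}^d\setminus\{0\}}\big(1-e^{i\langle\xi,h\rangle}+i\langle\xi,h\rangle\mathbf{1}_{B_1}(h)\big)\,\nu(dh);$$ equivalently, $\widehat{Af}(\xi)=-\psi(-\xi)\hat f(\xi)$ for $f\in\mathcal{S}(\mathbb{R}^d)$, where $\hat f(\xi)=\int_{\mathbb{R}^d}e^{i\langle\xi,x\rangle}f(x)\,dx$. The function $\ell:(0,R_0)\to(0,\infty)$ satisfies $\int_0^{R_0}\ell(s)\frac{ds}{s}=+\infty$ and, for some $c_L\in(0,1)$, $c_U\ge1$, $\gamma\in(0,2)$: - $\int_r^{R_0}\ell(s)\frac{ds}{s}<+\infty$ for $0<r<R_0$; - $\frac{\ell(r\lambda)}{\ell(r)}\ge c_L\lambda^{-\gamma}$ for $r>0$ and $1\le\lambda<\frac{R_0}{r}$; - $\frac{\ell(r\lambda)}{\ell(r)}\le c_U\lambda^{d}$ for $r>0$ and $1\le\lambda<\frac{R_0}{r}$. *)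

theory Defs
  imports "HOL-Analysis.Analysis"
begin

fun iter_partial :: "'a::euclidean_space list \<Rightarrow> ('a \<Rightarrow> complex) \<Rightarrow> 'a \<Rightarrow> complex" where
  "iter_partial [] u = u"
| "iter_partial (b # bs) u = (\<lambda>x. frechet_derivative (iter_partial bs u) (at x) b)"

text \<open>Differentiability of all iterated partial derivatives amounts to smoothness.\<close>

definition schwartz :: "('a::euclidean_space \<Rightarrow> complex) set" where
  "schwartz = {u. \<forall>bs. set bs \<subseteq> Basis \<longrightarrow>
      (\<forall>x. iter_partial bs u differentiable at x) \<and>
      (\<forall>n. bounded (range (\<lambda>x. norm x ^ n *\<^sub>R iter_partial bs u x)))}"

text \<open>The measure \<open>k(h) dh\<close> has the punctured space as its carrier, so plain integrals against it
  are integrals over the punctured space and \<open>k 0\<close> plays no role.\<close>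

definition levy_measure :: "('a::euclidean_space \<Rightarrow> real) \<Rightarrow> 'a measure" where
  "levy_measure k = density (restrict_space lborel (- {0})) (\<lambda>h. ennreal (k h))"

text \<open>The Frechet derivative at \<open>x\<close> applied to \<open>h\<close> is the pairing of the gradient with \<open>h\<close>.\<close>

definition levy_operator ::
    "'a::euclidean_space measure \<Rightarrow> ('a \<Rightarrow> complex) \<Rightarrow> 'a \<Rightarrow> complex" where
  "levy_operator \<nu> u x =
     (LINT h|\<nu>. u (x + h) - u x - indicator (ball 0 1) h *\<^sub>R frechet_derivative u (at x) h)"

definition characteristic_exponent :: "'a::euclidean_space measure \<Rightarrow> 'a \<Rightarrow> complex" where
  "characteristic_exponent \<nu> \<xi> =
     (LINT h|\<nu>. 1 - exp (\<i> * complex_of_real (\<xi> \<bullet> h))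
        + \<i> * complex_of_real (\<xi> \<bullet> h) * indicator (ball 0 1) h)"

text \<open>Since \<open>R\<^sub>0\<close> may be infinite it is an extended real; the integral below is over the
  reals \<open>s\<close> with \<open>r < s < R\<^sub>0\<close>.\<close>

definition scale_integral :: "ereal \<Rightarrow> (real \<Rightarrow> real) \<Rightarrow> real \<Rightarrow> real" where
  "scale_integral R\<^sub>0 l r = (LINT s:einterval (ereal r) R\<^sub>0|lborel. l s / s)"

end

theory Submission
  imports Defs
begin

text \<open>By symmetry \<open>\<psi>(\<xi>)\<close> is the integral of \<open>(1 - cos (\<xi> \<bullet> h)) k(h)\<close>. Put \<open>r = 1 / |\<xi>|\<close>.
  For the upper bound, \<open>1 - cos (\<xi> \<bullet> h) \<le> min 2 ((|h| / r)\<^sup>2)\<close>; in polar coordinates the part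
  \<open>|h| < r\<close> is at most a multiple of \<open>l r\<close> because \<open>\<gamma> < 2\<close>, and \<open>l r\<close> is at most a multiple of the
  integral of \<open>l(s) / s\<close> over \<open>[r, 2 r]\<close>. For the lower bound, the average of \<open>1 - cos (\<xi> \<bullet> h)\<close> over
  \<open>h\<close> and its translate by half a period is \<open>1\<close>, and the weight \<open>l(|h|) / |h|\<^sup>d\<close> does not drop by more
  than a constant factor under this translation when \<open>|h| \<ge> 4 r\<close> and \<open>\<xi> \<bullet> h \<ge> 0\<close>. Bounded errors
  (jumps larger than \<open>R\<^sub>0\<close>, and the scales near \<open>R\<^sub>0\<close>) are absorbed because \<open>L\<close> diverges at \<open>0\<close>.\<close>

section \<open>Polar coordinates and the symmetries of Lebesgue measure\<close>

text \<open>The half-lines \<open>{..<a}\<close> are stable under intersection and generate the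
  Borel sets, and the preimage of \<open>{..<a}\<close> under the norm is the ball of radius
  \<open>a\<close>. So it suffices to know the volume of that ball and its derivative in
  \<open>a\<close>.\<close>

lemma distr_norm_lborel:
  "distr lborel borel (norm :: 'a::euclidean_space \<Rightarrow> real) =
     density lborel (\<lambda>s. ennreal (indicator {0<..} s *
       (real DIM('a) * unit_ball_vol DIM('a) * s ^ (DIM('a) - 1))))"
    (is "?M = density lborel ?d")
proof (rule measure_eqI_generator_eq[where E = "range lessThan" and \<Omega> = UNIV
      and A = "\<lambda>i. {..<real i}"])
  define n where "n = DIM('a)"
  define \<omega> where "\<omega> = unit_ball_vol (real n)"
  have n: "n > 0" and \<omega>: "\<omega> \<ge> 0"
    by (auto simp: n_def \<omega>_def)
  fix X assume "X \<in> range (lessThan :: real \<Rightarrow> _)"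
  then obtain a where X: "X = {..<a}"
    by auto
  have "emeasure ?M X = emeasure lborel (ball (0::'a) a)"
    by (auto simp: X emeasure_distr vimage_def intro!: arg_cong[where f = "emeasure lborel"])
  also have "\<dots> = emeasure (density lborel ?d) X"
  proof (cases "a \<le> 0")
    case True
    then have "(\<integral>\<^sup>+ s. ?d s * indicator X s \<partial>lborel) = (\<integral>\<^sup>+ s. 0 \<partial>(lborel :: real measure))"
      by (intro nn_integral_cong) (auto simp: X split: split_indicator)
    then have "emeasure (density lborel ?d) X = 0"
      by (subst emeasure_density) (auto simp: X)
    then show ?thesis
      using True by (simp add: ball_empty)
  next
    case False
    have "((\<lambda>s. real n * \<omega> * s ^ (n - 1)) has_integral (\<omega> * a ^ n - \<omega> * 0 ^ n)) {0..a}"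
      using False
      by (intro fundamental_theorem_of_calculus)
         (auto intro!: derivative_eq_intros simp flip: has_real_derivative_iff_has_vector_derivative)
    then have "(\<integral>\<^sup>+ s. ennreal (real n * \<omega> * s ^ (n - 1)) * indicator {0..a} s \<partial>lborel)
        = ennreal (\<omega> * a ^ n)"
      using n \<omega> by (subst nn_integral_has_integral_lebesgue') (auto simp: zero_power)
    also have "(\<integral>\<^sup>+ s. ennreal (real n * \<omega> * s ^ (n - 1)) * indicator {0..a} s \<partial>lborel)
        = (\<integral>\<^sup>+ s. ?d s * indicator X s \<partial>lborel)"
    \<comment> \<open>The fundamental theorem gives the integral over the closed
      \<open>{0..a}\<close>, while the density is cut off at \<open>0\<close> and the half-line is
      open at \<open>a\<close>; two points form a null set.\<close>
    proof (rule nn_integral_cong_AE)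
      have "AE s in lborel. s \<noteq> 0 \<and> s \<noteq> a"
        by (intro AE_conjI AE_lborel_singleton)
      then show "AE s in lborel. ennreal (real n * \<omega> * s ^ (n - 1)) * indicator {0..a} s
          = ?d s * indicator X s"
        by eventually_elim (auto simp: X n_def \<omega>_def split: split_indicator)
    qed
    finally show ?thesis
      using False by (simp add: emeasure_ball emeasure_density X n_def \<omega>_def)
  qed
  finally show "emeasure ?M X = emeasure (density lborel ?d) X" .
next
  show "Int_stable (range (lessThan :: real \<Rightarrow> _))"
  proof (rule Int_stableI_image)
    show "\<exists>x\<in>UNIV. {..<a} \<inter> {..<b} = {..<x}" for a b :: real
      by (intro bexI[of _ "min a b"]) auto
  qed
  show "sets ?M = sigma_sets UNIV (range lessThan)"
    by (simp add: borel_Iio)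
  show "sets (density lborel ?d) = sigma_sets UNIV (range lessThan)"
    by (simp add: borel_Iio)
  show "(\<Union>i. {..<real i}) = UNIV"
    using reals_Archimedean2 by fastforce
  show "emeasure ?M {..<real i} \<noteq> \<infinity>" for i
  proof -
    have "emeasure ?M {..<real i} = emeasure lborel (ball (0::'a) (real i))"
      by (auto simp: emeasure_distr vimage_def intro!: arg_cong[where f = "emeasure lborel"])
    then show ?thesis
      by (simp add: emeasure_ball)
  qed
qed auto

lemma nn_integral_norm_lborel:
  fixes g :: "real \<Rightarrow> ennreal"
  assumes [measurable]: "g \<in> borel_measurable borel"
  shows "(\<integral>\<^sup>+ h. g (norm (h::'a::euclidean_space)) \<partial>lborel) =
     (\<integral>\<^sup>+ s. ennreal (indicator {0<..} s *
       (real DIM('a) * unit_ball_vol DIM('a) * s ^ (DIM('a) - 1))) * g s \<partial>lborel)"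
proof -
  have "(\<integral>\<^sup>+ h. g (norm (h::'a)) \<partial>lborel) = (\<integral>\<^sup>+ s. g s \<partial>distr lborel borel (norm :: 'a \<Rightarrow> real))"
    by (simp add: nn_integral_distr)
  then show ?thesis
    unfolding distr_norm_lborel by (simp add: nn_integral_density)
qed

lemma nn_integral_lborel_uminus:
  fixes g :: "'a::euclidean_space \<Rightarrow> ennreal"
  assumes [measurable]: "g \<in> borel_measurable borel"
  shows "(\<integral>\<^sup>+ h. g (- h) \<partial>lborel) = (\<integral>\<^sup>+ h. g h \<partial>lborel)"
proof -
  have "(lborel :: 'a measure) = distr lborel borel uminus"
    using lborel_affine[of "- 1" "0 :: 'a"] by (simp add: density_1)
  then have "(\<integral>\<^sup>+ h. g h \<partial>lborel) = (\<integral>\<^sup>+ h. g h \<partial>distr lborel borel uminus)"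
    by simp
  then show ?thesis
    by (simp add: nn_integral_distr)
qed

lemma integral_lborel_uminus:
  fixes g :: "'a::euclidean_space \<Rightarrow> real"
  assumes [measurable]: "g \<in> borel_measurable borel"
  shows "(\<integral> h. g (- h) \<partial>lborel) = (\<integral> h. g h \<partial>lborel)"
proof -
  have "(lborel :: 'a measure) = distr lborel borel uminus"
    using lborel_affine[of "- 1" "0 :: 'a"] by (simp add: density_1)
  then have "(\<integral> h. g h \<partial>lborel) = (\<integral> h. g h \<partial>distr lborel borel uminus)"
    by simp
  then show ?thesis
    by (simp add: integral_distr)
qed

lemma nn_integral_lborel_translate:
  fixes g :: "'a::euclidean_space \<Rightarrow> ennreal"
  assumes [measurable]: "g \<in> borel_measurable borel"
  shows "(\<integral>\<^sup>+ h. g (v + h) \<partial>lborel) = (\<integral>\<^sup>+ h. g h \<partial>lborel)"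
proof -
  have "(\<integral>\<^sup>+ h. g h \<partial>lborel) = (\<integral>\<^sup>+ h. g h \<partial>distr lborel borel ((+) v))"
    by (simp add: lborel_distr_plus)
  then show ?thesis
    by (simp add: nn_integral_distr)
qed

section \<open>Elementary inequalities for the cosine and the inner product\<close>

lemma one_minus_cos_le: "1 - cos x \<le> x\<^sup>2 / 2" for x :: real
proof -
  have "1 - cos x = 2 * (sin (x / 2))\<^sup>2"
    using cos_double_sin[of "x / 2"] by simp
  also have "\<dots> \<le> 2 * (x / 2)\<^sup>2"
    using abs_sin_x_le_abs_x[of "x / 2"]
    by (intro mult_left_mono) (auto simp only: abs_le_square_iff)
  finally show ?thesis
    by (simp add: power2_eq_square)
qed

lemma inner_squared_le: "(x \<bullet> y)\<^sup>2 \<le> (norm x)\<^sup>2 * (norm y)\<^sup>2" for x y :: "'a::real_inner"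
  using Cauchy_Schwarz_ineq2[of x y] by (simp add: abs_le_square_iff[symmetric] flip: power_mult_distrib)

section \<open>One-dimensional estimates for a weight with lower scaling\<close>

text \<open>\<open>f\<close> stands for \<open>l\<close> continued by zero outside the scales
  between \<open>0\<close> and \<open>R\<close>, so integrals over the line and over the space need
  no restriction. The scaling condition compares two scales directly, which avoids quotients of
  extended reals.\<close>

locale lower_scaling =
  fixes R :: ereal and f :: "real \<Rightarrow> real" and c \<gamma> :: real
  assumes f_measurable [measurable]: "f \<in> borel_measurable borel"
    and f_nonneg: "0 \<le> f s"
    and f_outside: "s \<notin> einterval 0 R \<Longrightarrow> f s = 0"
    and c: "0 < c" "c \<le> 1" and \<gamma>: "0 \<le> \<gamma>" "\<gamma> < 2"
    and f_lower: "0 < s \<Longrightarrow> s \<le> t \<Longrightarrow> ereal t < R \<Longrightarrow> c * (t / s) powr (- \<gamma>) * f s \<le> f t"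
begin

text \<open>The value is an extended nonnegative real, so that estimates can be chained before
  finiteness is known.\<close>

definition tail :: "real \<Rightarrow> ennreal" where
  "tail r = (\<integral>\<^sup>+ s. ennreal (f s / s) * indicator {r..} s \<partial>lborel)"

text \<open>The factor \<open>s ^ (n - 1)\<close> of polar coordinates against \<open>s ^ n\<close>
  in the denominator leaves \<open>1 / s\<close>, so that integrals over the space turn into
  integrals over scales.\<close>

lemma nn_integral_radial:
  fixes g :: "real \<Rightarrow> ennreal"
  assumes [measurable]: "g \<in> borel_measurable borel"
  shows "(\<integral>\<^sup>+ h. ennreal (f (norm h) / norm h ^ DIM('a)) * g (norm (h::'a::euclidean_space)) \<partial>lborel) =
     ennreal (real DIM('a) * unit_ball_vol DIM('a)) * (\<integral>\<^sup>+ s. ennreal (f s / s) * g s \<partial>lborel)"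
proof -
  define n where "n = DIM('a)"
  define \<omega> where "\<omega> = unit_ball_vol (real n)"
  have n: "n > 0" and \<omega>: "\<omega> \<ge> 0"
    by (auto simp: n_def \<omega>_def)
  have "ennreal (indicator {0<..} s * (real n * \<omega> * s ^ (n - 1))) * (ennreal (f s / s ^ n) * g s)
      = ennreal (real n * \<omega>) * (ennreal (f s / s) * g s)" for s
  proof (cases "s > 0")
    case True
    have "s ^ n = s * s ^ (n - 1)"
      using n by (cases n) auto
    then have "real n * \<omega> * s ^ (n - 1) * (f s / s ^ n) = real n * \<omega> * (f s / s)"
      using True by (simp add: field_simps)
    then show ?thesis
      using True \<omega> f_nonneg[of s]
      by (simp flip: mult.assoc ennreal_mult' add: ennreal_mult'[symmetric])
  next
    case False
    then have "f s = 0"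
      by (intro f_outside) (auto simp: einterval_iff)
    then show ?thesis
      using False by simp
  qed
  then show ?thesis
    by (subst nn_integral_norm_lborel) (auto simp: n_def \<omega>_def nn_integral_cmult)
qed

text \<open>On \<open>{r..2 * r}\<close> lower scaling keeps \<open>f s\<close> at least
  \<open>c * 2 powr (- \<gamma>) * f r\<close>, and \<open>1 / s\<close> is at least
  \<open>1 / (2 * r)\<close>; the shell has length \<open>r\<close>.\<close>

lemma dyadic_shell_ge:
  assumes r: "0 < r" "ereal (2 * r) < R"
  shows "ennreal (c * 2 powr (- \<gamma>) / 2 * f r)
    \<le> (\<integral>\<^sup>+ s. ennreal (f s / s) * indicator {r..2 * r} s \<partial>lborel)"
proof -
  have "ennreal (c * 2 powr (- \<gamma>) / 2 * f r)
      = ennreal (c * 2 powr (- \<gamma>) * f r / (2 * r)) * emeasure lborel {r..2 * r}"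
    using r c f_nonneg[of r] by (simp flip: ennreal_mult' add: ennreal_mult'[symmetric])
  also have "\<dots> = (\<integral>\<^sup>+ s. ennreal (c * 2 powr (- \<gamma>) * f r / (2 * r)) * indicator {r..2 * r} s \<partial>lborel)"
    by (simp add: nn_integral_cmult_indicator)
  also have "\<dots> \<le> (\<integral>\<^sup>+ s. ennreal (f s / s) * indicator {r..2 * r} s \<partial>lborel)"
  proof (intro nn_integral_mono)
    have *: "c * 2 powr (- \<gamma>) * f r / (2 * r) \<le> f s / s" if s: "s \<in> {r..2 * r}" for s
    proof (rule frac_le)
      have "c * 2 powr (- \<gamma>) * f r \<le> c * (s / r) powr (- \<gamma>) * f r"
        using s r c \<gamma> f_nonneg[of r]
        by (intro mult_right_mono mult_left_mono powr_mono2') (auto simp: field_simps)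
      also have "\<dots> \<le> f s"
        using s r by (intro f_lower) (auto intro: le_less_trans[of "ereal s" "ereal (2 * r)"])
      finally show "c * 2 powr (- \<gamma>) * f r \<le> f s" .
    qed (use s r f_nonneg in auto)
    show "ennreal (c * 2 powr (- \<gamma>) * f r / (2 * r)) * indicator {r..2 * r} s
        \<le> ennreal (f s / s) * indicator {r..2 * r} s" for s
      using * by (auto simp: ennreal_leI split: split_indicator)
  qed
  finally show ?thesis .
qed

text \<open>Lower scaling from \<open>s\<close> up to \<open>r\<close> bounds \<open>f s\<close> by
  \<open>f r / c * (r / s) powr \<gamma>\<close>. Against \<open>(s / r)\<^sup>2 / s\<close> this
  leaves a multiple of \<open>s powr (1 - \<gamma>)\<close>, which is integrable at \<open>0\<close>
  because \<open>\<gamma> < 2\<close>.\<close>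

lemma truncated_second_moment_le:
  assumes r: "0 < r" "ereal r < R"
  shows "(\<integral>\<^sup>+ s. ennreal (f s / s) * (ennreal ((s / r)\<^sup>2) * indicator {..<r} s) \<partial>lborel)
    \<le> ennreal (f r / (c * (2 - \<gamma>)))"
proof -
  have "((\<lambda>s. s powr (1 - \<gamma>)) has_integral r powr (2 - \<gamma>) / (2 - \<gamma>)) {0..r}"
    using has_integral_powr_from_0[of "1 - \<gamma>" r] \<gamma> r by (simp add: algebra_simps)
  from has_integral_mult_right[OF this, of "r powr (\<gamma> - 2) * f r / c"]
  have "((\<lambda>s. r powr (\<gamma> - 2) * f r / c * s powr (1 - \<gamma>)) has_integral
      (r powr (\<gamma> - 2) * r powr (2 - \<gamma>)) * (f r / (c * (2 - \<gamma>)))) {0..r}"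
    by (simp add: mult_ac)
  moreover have "r powr (\<gamma> - 2) * r powr (2 - \<gamma>) = 1"
    using r by (simp flip: powr_add)
  ultimately
  have "((\<lambda>s. r powr (\<gamma> - 2) * f r / c * s powr (1 - \<gamma>)) has_integral f r / (c * (2 - \<gamma>))) {0..r}"
    by simp
  from nn_integral_has_integral_lebesgue'[OF _ this]
  have *: "(\<integral>\<^sup>+ s. ennreal (r powr (\<gamma> - 2) * f r / c * s powr (1 - \<gamma>)) * indicator {0..r} s \<partial>lborel)
      = ennreal (f r / (c * (2 - \<gamma>)))"
    using r c f_nonneg[of r] by simp
  have "(\<integral>\<^sup>+ s. ennreal (f s / s) * (ennreal ((s / r)\<^sup>2) * indicator {..<r} s) \<partial>lborel)
      \<le> (\<integral>\<^sup>+ s. ennreal (r powr (\<gamma> - 2) * f r / c * s powr (1 - \<gamma>)) * indicator {0..r} s \<partial>lborel)"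
  proof (rule nn_integral_mono)
    fix s
    show "ennreal (f s / s) * (ennreal ((s / r)\<^sup>2) * indicator {..<r} s)
        \<le> ennreal (r powr (\<gamma> - 2) * f r / c * s powr (1 - \<gamma>)) * indicator {0..r} s"
    proof (cases "0 < s \<and> s < r")
      case True
      then have "c * (r / s) powr (- \<gamma>) * f s \<le> f r"
        using r by (intro f_lower) auto
      then have "f s \<le> f r / c * (r / s) powr \<gamma>"
        using c True r by (simp add: powr_minus field_simps)
      then have "f s / s * (s / r)\<^sup>2 \<le> f r / c * (r / s) powr \<gamma> / s * (s / r)\<^sup>2"
        using True by (intro mult_right_mono divide_right_mono) auto
      also have "\<dots> = r powr (\<gamma> - 2) * f r / c * s powr (1 - \<gamma>)"
        using True r c by (simp add: powr_diff powr_divide power2_eq_square field_simps)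
      finally show ?thesis
        using True f_nonneg[of s]
        by (simp flip: ennreal_mult' add: ennreal_mult'[symmetric] ennreal_leI)
    next
      case False
      then have "s \<ge> r \<or> f s = 0"
        using f_outside[of s] by (auto simp: einterval_iff)
      then show ?thesis
        by (auto split: split_indicator)
    qed
  qed
  then show ?thesis
    unfolding * .
qed

lemma profile_le_tail:
  assumes r: "0 < r" "ereal (2 * r) < R"
  shows "ennreal (c * 2 powr (- \<gamma>) / 2 * f r) \<le> tail r"
  using dyadic_shell_ge[OF r] unfolding tail_def
  by (rule order_trans) (auto intro!: nn_integral_mono split: split_indicator)

text \<open>In this form the contribution of the scales below \<open>r\<close>, once reduced to a
  multiple of \<open>f r\<close>, is charged to the tail.\<close>

lemma profile_le_tail':
  assumes r: "0 < r" "ereal (2 * r) < R" and a: "0 \<le> a"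
  shows "ennreal (a * f r) \<le> ennreal (2 * 2 powr \<gamma> * a / c) * tail r"
proof -
  have "a * f r = (2 * 2 powr \<gamma> * a / c) * (c * 2 powr (- \<gamma>) / 2 * f r)"
    using c by (simp add: powr_minus field_simps)
  then have "ennreal (a * f r) = ennreal (2 * 2 powr \<gamma> * a / c) * ennreal (c * 2 powr (- \<gamma>) / 2 * f r)"
    using a c by (metis divide_nonneg_pos ennreal_mult' mult_nonneg_nonneg powr_ge_zero zero_le_numeral)
  then show ?thesis
    using profile_le_tail[OF r] by (simp add: mult_left_mono)
qed

text \<open>The condition \<open>2 * s < R\<close> leaves room for a translation: a point of norm
  \<open>s\<close> may move to norm at most \<open>2 * s\<close> and still be where lower scaling
  applies.\<close>

definition middle :: "real \<Rightarrow> ennreal" where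
  "middle r = (\<integral>\<^sup>+ s. ennreal (f s / s) * indicator {s. r \<le> s \<and> ereal (2 * s) < R} s \<partial>lborel)"

text \<open>The scales from \<open>r\<close> to \<open>4 * r\<close> cost a multiple of
  \<open>f (4 * r)\<close>, which the dyadic shell above \<open>4 * r\<close> inside
  \<open>middle\<close> repays. The scales with \<open>2 * s\<close> not below \<open>R\<close> lie
  beyond \<open>\<rho> / 2\<close>; that last term does not depend on \<open>r\<close> and can be
  absorbed later.\<close>

lemma tail_le_middle:
  assumes r: "0 < r" "ereal (16 * r) < R" and \<rho>: "ereal \<rho> \<le> R"
  shows "tail r \<le> ennreal (6 * 8 powr \<gamma> / c\<^sup>2 + 1) * middle (4 * r) + tail (\<rho> / 2)"
proof -
  let ?P = "\<integral>\<^sup>+ s. ennreal (f s / s) * indicator {r..4 * r} s \<partial>lborel"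
  have 4: "ereal (4 * r) < R"
    using r by (auto intro: le_less_trans[of _ "ereal (16 * r)"])
  have "?P \<le> (\<integral>\<^sup>+ s. ennreal (4 powr \<gamma> / c * f (4 * r) / r) * indicator {r..4 * r} s \<partial>lborel)"
  proof (rule nn_integral_mono)
    have *: "f s / s \<le> 4 powr \<gamma> / c * f (4 * r) / r" if s: "s \<in> {r..4 * r}" for s
    proof (rule frac_le)
      have "4 powr (- \<gamma>) \<le> (4 * r / s) powr (- \<gamma>)"
        using s r \<gamma> by (intro powr_mono2') (auto simp: field_simps)
      then have "c * 4 powr (- \<gamma>) * f s \<le> c * (4 * r / s) powr (- \<gamma>) * f s"
        using c f_nonneg by (intro mult_right_mono mult_left_mono) auto
      also have "\<dots> \<le> f (4 * r)"
        using s r 4 by (intro f_lower) auto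
      finally show "f s \<le> 4 powr \<gamma> / c * f (4 * r)"
        using c by (simp add: powr_minus field_simps)
    qed (use s r c f_nonneg in auto)
    show "ennreal (f s / s) * indicator {r..4 * r} s
        \<le> ennreal (4 powr \<gamma> / c * f (4 * r) / r) * indicator {r..4 * r} s" for s
      using * by (auto simp: ennreal_leI split: split_indicator)
  qed
  also have "\<dots> = ennreal (4 powr \<gamma> / c * f (4 * r) / r) * ennreal (3 * r)"
    using r by (simp add: nn_integral_cmult_indicator)
  \<comment> \<open>The interval of length \<open>3 * r\<close> gives
    \<open>3 * 4 powr \<gamma> / c\<close>; dividing by the factor
    \<open>c * 2 powr (- \<gamma>) / 2\<close> of the dyadic bound gives the new constant.\<close>
  also have "\<dots> = ennreal (6 * 8 powr \<gamma> / c\<^sup>2) * ennreal (c * 2 powr (- \<gamma>) / 2 * f (4 * r))"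
  proof -
    have "(8::real) powr \<gamma> = 4 powr \<gamma> * 2 powr \<gamma>"
      by (simp flip: powr_mult)
    then have "4 powr \<gamma> / c * f (4 * r) / r * (3 * r) = 6 * 8 powr \<gamma> / c\<^sup>2 * (c * 2 powr (- \<gamma>) / 2 * f (4 * r))"
      using c r by (simp add: powr_minus field_simps power2_eq_square)
    then show ?thesis
      using c r f_nonneg[of "4 * r"] by (simp flip: ennreal_mult')
  qed
  also have "ennreal (c * 2 powr (- \<gamma>) / 2 * f (4 * r)) \<le> middle (4 * r)"
  proof -
    have "ennreal (c * 2 powr (- \<gamma>) / 2 * f (4 * r))
        \<le> (\<integral>\<^sup>+ s. ennreal (f s / s) * indicator {4 * r..2 * (4 * r)} s \<partial>lborel)"
      using r by (intro dyadic_shell_ge) (auto intro: le_less_trans[of _ "ereal (16 * r)"])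
    also have "\<dots> \<le> middle (4 * r)"
      unfolding middle_def using r
      by (intro nn_integral_mono)
         (auto split: split_indicator intro: le_less_trans[of _ "ereal (16 * r)"])
    finally show ?thesis .
  qed
  finally have P: "?P \<le> ennreal (6 * 8 powr \<gamma> / c\<^sup>2) * middle (4 * r)"
    by (simp add: mult_left_mono)
  \<comment> \<open>The three ranges cover \<open>{r..}\<close>, and overlaps are harmless in an
    upper bound.\<close>
  have "tail r \<le> (\<integral>\<^sup>+ s. ennreal (f s / s) * indicator {r..4 * r} s
      + ennreal (f s / s) * indicator {s. 4 * r \<le> s \<and> ereal (2 * s) < R} s
      + ennreal (f s / s) * indicator {\<rho> / 2..} s \<partial>lborel)"
    unfolding tail_def
  proof (rule nn_integral_mono)
    fix s
    have "\<rho> / 2 \<le> s" if "\<not> ereal (2 * s) < R"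
    proof -
      have "ereal \<rho> \<le> ereal (2 * s)"
        using that \<rho> by (meson not_le order_trans)
      then show ?thesis by simp
    qed
    then show "ennreal (f s / s) * indicator {r..} s \<le> ennreal (f s / s) * indicator {r..4 * r} s
      + ennreal (f s / s) * indicator {s. 4 * r \<le> s \<and> ereal (2 * s) < R} s
      + ennreal (f s / s) * indicator {\<rho> / 2..} s"
      by (auto split: split_indicator)
  qed
  also have "\<dots> = ?P + middle (4 * r) + tail (\<rho> / 2)"
    unfolding middle_def tail_def by (simp add: nn_integral_add)
  also have "\<dots> \<le> ennreal (6 * 8 powr \<gamma> / c\<^sup>2) * middle (4 * r) + middle (4 * r) + tail (\<rho> / 2)"
    by (intro add_mono P order_refl)
  also have "\<dots> = ennreal (6 * 8 powr \<gamma> / c\<^sup>2 + 1) * middle (4 * r) + tail (\<rho> / 2)"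
    by (simp add: distrib_right)
  finally show ?thesis .
qed

text \<open>Monotone convergence as the cutoff tends to \<open>0\<close> yields one good cutoff, and
  the tail only grows when the cutoff shrinks further.\<close>

lemma tail_unbounded:
  assumes top: "(\<integral>\<^sup>+ s. ennreal (f s / s) \<partial>lborel) = \<infinity>" and M: "M < \<infinity>"
  shows "\<exists>r\<^sub>1>0. \<forall>r. 0 < r \<longrightarrow> r \<le> r\<^sub>1 \<longrightarrow> M < tail r"
proof -
  \<comment> \<open>\<open>Suc\<close> keeps every cutoff positive: \<open>1 / 0\<close> is
    \<open>0\<close>, and the sequence would then not be increasing.\<close>
  let ?g = "\<lambda>i s. ennreal (f s / s) * indicator {1 / real (Suc i)..} s"
  have "(SUP i. ?g i s) = ennreal (f s / s)" for s
  proof (cases "0 < s")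
    case True
    then obtain i where "1 / real (Suc i) < s"
      using reals_Archimedean by (auto simp: inverse_eq_divide)
    then show ?thesis
      by (intro antisym SUP_least SUP_upper2[of i]) (auto split: split_indicator)
  next
    case False
    then have "f s = 0"
      by (intro f_outside) (auto simp: einterval_iff)
    then show ?thesis by simp
  qed
  then have "\<infinity> = (\<integral>\<^sup>+ s. (SUP i. ?g i s) \<partial>lborel)"
    using top by simp
  also have "\<dots> = (SUP i. integral\<^sup>N lborel (?g i))"
  proof (rule nn_integral_monotone_convergence_SUP)
    show "incseq ?g"
    proof (intro incseq_SucI le_funI mult_left_mono)
      fix i s
      have "1 / real (Suc (Suc i)) \<le> 1 / real (Suc i)"
        by (simp add: frac_le)
      then have "{1 / real (Suc i)..} \<subseteq> {1 / real (Suc (Suc i))..}"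
        by simp
      then show "(indicator {1 / real (Suc i)..} s :: ennreal) \<le> indicator {1 / real (Suc (Suc i))..} s"
        by (auto split: split_indicator)
    qed simp
  qed auto
  finally have "M < (SUP i. integral\<^sup>N lborel (?g i))"
    using M by simp
  then obtain i where i: "M < integral\<^sup>N lborel (?g i)"
    unfolding less_SUP_iff by blast
  have "integral\<^sup>N lborel (?g i) \<le> tail r" if "r \<le> 1 / real (Suc i)" for r
    unfolding tail_def using that by (auto intro!: nn_integral_mono split: split_indicator)
  then show ?thesis
    using i by (intro exI[of _ "1 / real (Suc i)"]) (auto intro: less_le_trans)
qed

section \<open>Comparison of the integral of 1 - cos with the tail\<close>

text \<open>The factor \<open>1 - cos (\<xi> \<bullet> h)\<close> is quadratically small for
  \<open>norm h\<close> below \<open>1 / norm \<xi>\<close>, where the truncated second moment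
  applies, and at most \<open>2\<close> elsewhere. Jumps to which \<open>k_le\<close> does not apply
  go into the last term, which is independent of \<open>\<xi>\<close>.\<close>

lemma oscillation_le_tail:
  fixes k :: "'a::euclidean_space \<Rightarrow> real"
  assumes [measurable]: "k \<in> borel_measurable borel" and k: "\<And>h. 0 \<le> k h"
    and \<kappa>: "0 \<le> \<kappa>"
    and k_le: "\<And>h. h \<noteq> 0 \<Longrightarrow> ereal (norm h) < R \<Longrightarrow> k h \<le> \<kappa> * (f (norm h) / norm h ^ DIM('a))"
    and \<rho>: "ereal \<rho> \<le> R"
    and \<xi>: "\<xi> \<noteq> 0" "ereal (2 / norm \<xi>) < R"
  shows "(\<integral>\<^sup>+ h. ennreal ((1 - cos (\<xi> \<bullet> h)) * k h) \<partial>lborel)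
    \<le> ennreal (real DIM('a) * unit_ball_vol DIM('a) *
        (2 powr \<gamma> * \<kappa> / (c\<^sup>2 * (2 - \<gamma>)) + 2 * \<kappa>)) * tail (1 / norm \<xi>)
      + 2 * (\<integral>\<^sup>+ h. ennreal (k h) * indicator {\<rho>..} (norm h) \<partial>lborel)"
proof -
  define r where "r = 1 / norm \<xi>"
  have r: "0 < r" "ereal (2 * r) < R"
    using \<xi> by (auto simp: r_def)
  have r': "ereal r < R"
    using r by (auto intro: le_less_trans[of _ "ereal (2 * r)"])
  \<comment> \<open>A radial majorant of \<open>1 - cos (\<xi> \<bullet> h)\<close> times
    \<open>\<kappa>\<close>: by Cauchy-Schwarz \<open>(s / r)\<^sup>2 / 2\<close> below
    \<open>r\<close>, and \<open>2\<close> from \<open>r\<close> on.\<close>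
  define G where "G s = ennreal (\<kappa> / 2) * (ennreal ((s / r)\<^sup>2) * indicator {..<r} s)
    + ennreal (2 * \<kappa>) * indicator {r..} s" for s :: real
  have [measurable]: "G \<in> borel_measurable borel"
    unfolding G_def by measurable
  define N where "N = real DIM('a) * unit_ball_vol DIM('a)"
  have N: "N \<ge> 0" by (simp add: N_def)
  let ?w = "\<lambda>h::'a. f (norm h) / norm h ^ DIM('a)"
  have pointwise: "ennreal ((1 - cos (\<xi> \<bullet> h)) * k h)
      \<le> ennreal (?w h) * G (norm h) + 2 * (ennreal (k h) * indicator {\<rho>..} (norm h))" for h
  proof -
    have cos_le_2: "1 - cos (\<xi> \<bullet> h) \<le> 2"
      using cos_ge_minus_one[of "\<xi> \<bullet> h"] by linarith
    have w: "?w h \<ge> 0"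
      using f_nonneg by simp
    \<comment> \<open>The origin is separate because \<open>k_le\<close> excludes it; there the
      cosine is \<open>1\<close> and the left side vanishes.\<close>
    consider "h = 0" | "h \<noteq> 0" "ereal (norm h) < R" "norm h < r"
      | "h \<noteq> 0" "ereal (norm h) < R" "norm h \<ge> r" | "\<not> ereal (norm h) < R"
      by fastforce
    then show ?thesis
    proof cases
      case 1
      then show ?thesis by simp
    next
      case 2
      have "1 - cos (\<xi> \<bullet> h) \<le> (\<xi> \<bullet> h)\<^sup>2 / 2"
        by (rule one_minus_cos_le)
      also have "\<dots> \<le> (norm h / r)\<^sup>2 / 2"
        using inner_squared_le[of \<xi> h] by (simp add: r_def power_mult_distrib mult.commute)
      finally have "(1 - cos (\<xi> \<bullet> h)) * k h \<le> (norm h / r)\<^sup>2 / 2 * (\<kappa> * ?w h)"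
        using k_le[OF 2(1,2)] k[of h] by (intro mult_mono) auto
      then have "ennreal ((1 - cos (\<xi> \<bullet> h)) * k h) \<le> ennreal (?w h * (\<kappa> / 2 * (norm h / r)\<^sup>2))"
        by (intro ennreal_leI) (simp add: mult_ac)
      also have "\<dots> = ennreal (?w h) * G (norm h)"
        using 2 \<kappa> w by (simp add: G_def ennreal_mult' flip: ennreal_mult')
      finally show ?thesis
        by (rule order_trans) simp
    next
      case 3
      have "(1 - cos (\<xi> \<bullet> h)) * k h \<le> 2 * (\<kappa> * ?w h)"
        using k_le[OF 3(1,2)] k[of h] cos_le_2 by (intro mult_mono) auto
      then have "ennreal ((1 - cos (\<xi> \<bullet> h)) * k h) \<le> ennreal (?w h * (2 * \<kappa>))"
        by (intro ennreal_leI) (simp add: mult_ac)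
      also have "\<dots> = ennreal (?w h) * G (norm h)"
        using 3 \<kappa> w by (simp add: G_def flip: ennreal_mult')
      finally show ?thesis
        by (rule order_trans) simp
    next
      case 4
      then have "ereal \<rho> \<le> ereal (norm h)"
        using \<rho> by (meson le_less_trans not_le)
      moreover have "ennreal ((1 - cos (\<xi> \<bullet> h)) * k h) \<le> ennreal (2 * k h)"
        using k[of h] cos_le_2 by (intro ennreal_leI mult_right_mono) auto
      ultimately show ?thesis
        by (simp add: ennreal_mult' add_increasing)
    qed
  qed
  have "(\<integral>\<^sup>+ s. ennreal (f s / s) * G s \<partial>lborel)
      = ennreal (\<kappa> / 2) * (\<integral>\<^sup>+ s. ennreal (f s / s) * (ennreal ((s / r)\<^sup>2) * indicator {..<r} s) \<partial>lborel)
        + ennreal (2 * \<kappa>) * tail r"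
  proof -
    have "ennreal (f s / s) * G s
        = ennreal (\<kappa> / 2) * (ennreal (f s / s) * (ennreal ((s / r)\<^sup>2) * indicator {..<r} s))
          + ennreal (2 * \<kappa>) * (ennreal (f s / s) * indicator {r..} s)" for s
      by (simp add: G_def distrib_left mult_ac)
    then show ?thesis
      unfolding tail_def by (simp add: nn_integral_add nn_integral_cmult)
  qed
  also have "\<dots> \<le> ennreal (\<kappa> / 2) * ennreal (f r / (c * (2 - \<gamma>))) + ennreal (2 * \<kappa>) * tail r"
    using r r' by (intro add_mono mult_left_mono truncated_second_moment_le) auto
  also have "ennreal (\<kappa> / 2) * ennreal (f r / (c * (2 - \<gamma>))) = ennreal (\<kappa> / (2 * c * (2 - \<gamma>)) * f r)"
    using \<kappa> by (simp add: mult.assoc flip: ennreal_mult')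
  also have "\<dots> \<le> ennreal (2 * 2 powr \<gamma> * (\<kappa> / (2 * c * (2 - \<gamma>))) / c) * tail r"
    using r \<kappa> c \<gamma> by (intro profile_le_tail') auto
  also have "2 * 2 powr \<gamma> * (\<kappa> / (2 * c * (2 - \<gamma>))) / c = 2 powr \<gamma> * \<kappa> / (c\<^sup>2 * (2 - \<gamma>))"
    by (simp add: power2_eq_square)
  also have "ennreal \<dots> * tail r + ennreal (2 * \<kappa>) * tail r
      = ennreal (2 powr \<gamma> * \<kappa> / (c\<^sup>2 * (2 - \<gamma>)) + 2 * \<kappa>) * tail r"
    using \<kappa> \<gamma> by (simp add: distrib_right)
  finally have G_le: "(\<integral>\<^sup>+ s. ennreal (f s / s) * G s \<partial>lborel)
      \<le> ennreal (2 powr \<gamma> * \<kappa> / (c\<^sup>2 * (2 - \<gamma>)) + 2 * \<kappa>) * tail r"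
    by (simp add: add_mono)
  have "(\<integral>\<^sup>+ h. ennreal ((1 - cos (\<xi> \<bullet> h)) * k h) \<partial>lborel)
      \<le> (\<integral>\<^sup>+ h. ennreal (?w h) * G (norm h) + 2 * (ennreal (k h) * indicator {\<rho>..} (norm h)) \<partial>lborel)"
    by (intro nn_integral_mono pointwise)
  also have "\<dots> = ennreal N * (\<integral>\<^sup>+ s. ennreal (f s / s) * G s \<partial>lborel)
      + 2 * (\<integral>\<^sup>+ h. ennreal (k h) * indicator {\<rho>..} (norm h) \<partial>lborel)"
    by (simp add: nn_integral_add nn_integral_cmult nn_integral_radial N_def)
  also have "\<dots> \<le> ennreal N * (ennreal (2 powr \<gamma> * \<kappa> / (c\<^sup>2 * (2 - \<gamma>)) + 2 * \<kappa>) * tail r)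
      + 2 * (\<integral>\<^sup>+ h. ennreal (k h) * indicator {\<rho>..} (norm h) \<partial>lborel)"
    by (intro add_mono mult_left_mono G_le) auto
  finally show ?thesis
    using N by (simp add: N_def r_def ennreal_mult' mult.assoc)
qed

text \<open>Translation by \<open>\<pi> \<xi> / |\<xi>|\<^sup>2\<close> changes the sign of \<open>cos (\<xi> \<bullet> h)\<close>, so the two translates of
  \<open>1 - cos (\<xi> \<bullet> h)\<close> add up to \<open>2\<close>. In the half space \<open>\<xi> \<bullet> h \<ge> 0\<close> the translation increases the norm,
  by at most a factor \<open>2\<close>, and then the weight drops by at most a constant factor.\<close>

lemma middle_le_oscillation:
  fixes \<xi> :: "'a::euclidean_space"
  assumes \<xi>: "\<xi> \<noteq> 0"
  shows "ennreal (real DIM('a) * unit_ball_vol DIM('a) * c / (2 powr \<gamma> * 2 ^ DIM('a))) * middle (4 / norm \<xi>)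
    \<le> 2 * (\<integral>\<^sup>+ h. ennreal ((1 - cos (\<xi> \<bullet> h)) * (f (norm h) / norm h ^ DIM('a))) \<partial>lborel)"
proof -
  define n where "n = DIM('a)"
  define N where "N = real n * unit_ball_vol n"
  have N: "N \<ge> 0" by (simp add: N_def)
  \<comment> \<open>The loss under translation: \<open>c\<close> and \<open>2 powr \<gamma>\<close>
    come from lower scaling, \<open>2 ^ n\<close> from the power of the norm. By
    \<open>a \<le> 1\<close> the untranslated weight dominates \<open>a * w h\<close> as
    well.\<close>
  define a where "a = c / (2 powr \<gamma> * 2 ^ n)"
  have a: "0 \<le> a" "a \<le> 1"
  proof -
    have "2 powr \<gamma> * 2 ^ n \<ge> (1::real) * 1"
      using \<gamma> by (intro mult_mono) (auto simp: ge_one_powr_ge_zero)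
    then show "0 \<le> a" "a \<le> 1"
      using c by (auto simp: a_def field_simps)
  qed
  define w where "w h = f (norm h) / norm h ^ n" for h :: 'a
  have [measurable]: "w \<in> borel_measurable borel"
    unfolding w_def by measurable
  have w_nonneg: "w h \<ge> 0" for h
    by (simp add: w_def f_nonneg)
  define v where "v = (pi / (norm \<xi>)\<^sup>2) *\<^sub>R \<xi>"
  have \<xi>v: "\<xi> \<bullet> v = pi"
    using \<xi> by (simp add: v_def power2_norm_eq_inner)
  have norm_v: "norm v = pi / norm \<xi>"
    using \<xi> by (simp add: v_def power2_eq_square)
  \<comment> \<open>As \<open>pi < 4\<close>, the lower bound on \<open>norm h\<close> makes
    \<open>h\<close> at least as long as \<open>v\<close>, so that \<open>v + h\<close> is at most
    twice as long as \<open>h\<close>; the last condition then keeps \<open>v + h\<close> in the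
    range of lower scaling.\<close>
  define S where "S = {h. 0 \<le> \<xi> \<bullet> h \<and> 4 / norm \<xi> \<le> norm h \<and> ereal (2 * norm h) < R}"
  have [measurable]: "S \<in> sets borel"
    unfolding S_def by measurable
  let ?I = "\<integral>\<^sup>+ h. ennreal ((1 - cos (\<xi> \<bullet> h)) * w h) \<partial>lborel"
  have w_translate: "a * w h \<le> w (v + h)" if h: "h \<in> S" for h
  proof -
    have "0 < 4 / norm \<xi>"
      using \<xi> by simp
    also have "\<dots> \<le> norm h"
      using h by (simp add: S_def)
    finally have h_pos: "0 < norm h" .
    have "0 \<le> h \<bullet> v"
      using h by (simp add: S_def v_def inner_commute[of h])
    then have "(norm h)\<^sup>2 \<le> (norm (v + h))\<^sup>2"
      using inner_ge_zero[of v] by (simp add: power2_norm_eq_inner inner_add_left inner_add_right inner_commute[of v h])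
    then have ge: "norm h \<le> norm (v + h)"
      by (rule power2_le_imp_le) simp
    have "norm v \<le> 4 / norm \<xi>"
      unfolding norm_v using pi_less_4 by (intro divide_right_mono) auto
    then have le: "norm (v + h) \<le> 2 * norm h"
      using norm_triangle_ineq[of v h] h by (simp add: S_def)
    have "c * 2 powr (- \<gamma>) * f (norm h) \<le> c * (norm (v + h) / norm h) powr (- \<gamma>) * f (norm h)"
      using ge le h_pos c \<gamma> f_nonneg
      by (intro mult_right_mono mult_left_mono powr_mono2') (auto simp: field_simps)
    also have "\<dots> \<le> f (norm (v + h))"
      using h_pos ge le h
      by (intro f_lower) (auto simp: S_def intro: le_less_trans[of _ "ereal (2 * norm h)"])
    finally have "c * 2 powr (- \<gamma>) * f (norm h) / (2 * norm h) ^ n \<le> f (norm (v + h)) / norm (v + h) ^ n"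
      using ge le less_le_trans[OF h_pos ge] f_nonneg by (intro frac_le power_mono zero_less_power) auto
    moreover have "a * w h = c * 2 powr (- \<gamma>) * f (norm h) / (2 * norm h) ^ n"
      by (simp add: a_def w_def powr_minus power_mult_distrib divide_inverse mult_ac)
    ultimately show ?thesis
      by (simp add: w_def)
  qed
  have "ennreal (2 * a) * (\<integral>\<^sup>+ h. ennreal (w h) * indicator S h \<partial>lborel)
      = (\<integral>\<^sup>+ h. ennreal (2 * a * w h) * indicator S h \<partial>lborel)"
    using a by (simp add: ennreal_mult' mult.assoc nn_integral_cmult)
  also have "\<dots> \<le> (\<integral>\<^sup>+ h. ennreal ((1 - cos (\<xi> \<bullet> h)) * w h)
      + ennreal ((1 - cos (\<xi> \<bullet> (v + h))) * w (v + h)) \<partial>lborel)"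
  proof (rule nn_integral_mono)
    fix h
    have nn: "0 \<le> (1 - cos (\<xi> \<bullet> h')) * w h'" for h'
      using w_nonneg by (intro mult_nonneg_nonneg) auto
    show "ennreal (2 * a * w h) * indicator S h \<le> ennreal ((1 - cos (\<xi> \<bullet> h)) * w h)
      + ennreal ((1 - cos (\<xi> \<bullet> (v + h))) * w (v + h))"
    proof (cases "h \<in> S")
      case True
      \<comment> \<open>The number \<open>2\<close> is split into 1 - cos and 1 + cos; the second is
        the oscillation at \<open>v + h\<close>, because
        \<open>\<xi> \<bullet> v = pi\<close>.\<close>
      have "2 * a * w h = (1 - cos (\<xi> \<bullet> h)) * (a * w h) + (1 + cos (\<xi> \<bullet> h)) * (a * w h)"
        by (simp add: algebra_simps)
      also have "\<dots> \<le> (1 - cos (\<xi> \<bullet> h)) * w h + (1 + cos (\<xi> \<bullet> h)) * w (v + h)"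
      proof (intro add_mono mult_left_mono)
        show "a * w h \<le> w h"
          using a w_nonneg[of h] by (simp add: mult_left_le_one_le)
        show "0 \<le> 1 + cos (\<xi> \<bullet> h)"
          using cos_ge_minus_one[of "\<xi> \<bullet> h"] by linarith
      qed (use w_translate[OF True] in auto)
      also have "1 + cos (\<xi> \<bullet> h) = 1 - cos (\<xi> \<bullet> (v + h))"
        by (simp add: inner_add_right \<xi>v cos_add)
      finally have "ennreal (2 * a * w h) \<le> ennreal ((1 - cos (\<xi> \<bullet> h)) * w h + (1 - cos (\<xi> \<bullet> (v + h))) * w (v + h))"
        by (rule ennreal_leI)
      then show ?thesis
        using True nn by (simp add: ennreal_plus)
    qed auto
  qed
  also have "\<dots> = ?I + (\<integral>\<^sup>+ h. ennreal ((1 - cos (\<xi> \<bullet> (v + h))) * w (v + h)) \<partial>lborel)"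
    by (simp add: nn_integral_add)
  also have "(\<integral>\<^sup>+ h. ennreal ((1 - cos (\<xi> \<bullet> (v + h))) * w (v + h)) \<partial>lborel) = ?I"
    by (rule nn_integral_lborel_translate[of "\<lambda>h. ennreal ((1 - cos (\<xi> \<bullet> h)) * w h)"]) measurable
  finally have S_le: "ennreal (2 * a) * (\<integral>\<^sup>+ h. ennreal (w h) * indicator S h \<partial>lborel) \<le> 2 * ?I"
    by (simp only: mult_2[of ?I])
  have "ennreal N * middle (4 / norm \<xi>) = (\<integral>\<^sup>+ h. ennreal (w h) *
      indicator {s. 4 / norm \<xi> \<le> s \<and> ereal (2 * s) < R} (norm h) \<partial>lborel)"
    unfolding middle_def w_def N_def n_def by (subst nn_integral_radial) auto
  \<comment> \<open>\<open>S\<close> and its reflection together cover both half spaces, and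
    \<open>w\<close> is radial, so the two contribute equally.\<close>
  also have "\<dots> \<le> (\<integral>\<^sup>+ h. ennreal (w h) * indicator S h + ennreal (w (- h)) * indicator S (- h) \<partial>lborel)"
  proof (rule nn_integral_mono)
    fix h
    show "ennreal (w h) * indicator {s. 4 / norm \<xi> \<le> s \<and> ereal (2 * s) < R} (norm h)
        \<le> ennreal (w h) * indicator S h + ennreal (w (- h)) * indicator S (- h)"
      by (cases "0 \<le> \<xi> \<bullet> h") (auto simp: S_def w_def indicator_def)
  qed
  also have "\<dots> = (\<integral>\<^sup>+ h. ennreal (w h) * indicator S h \<partial>lborel)
      + (\<integral>\<^sup>+ h. ennreal (w (- h)) * indicator S (- h) \<partial>lborel)"
    by (simp add: nn_integral_add)
  also have "(\<integral>\<^sup>+ h. ennreal (w (- h)) * indicator S (- h) \<partial>lborel) = (\<integral>\<^sup>+ h. ennreal (w h) * indicator S h \<partial>lborel)"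
    by (rule nn_integral_lborel_uminus[of "\<lambda>h. ennreal (w h) * indicator S h"]) measurable
  finally have N_le: "ennreal N * middle (4 / norm \<xi>) \<le> 2 * (\<integral>\<^sup>+ h. ennreal (w h) * indicator S h \<partial>lborel)"
    by (simp only: mult_2[of "\<integral>\<^sup>+ h. _ h \<partial>lborel"])
  have "ennreal (N * a) * middle (4 / norm \<xi>) = ennreal a * (ennreal N * middle (4 / norm \<xi>))"
    using a N by (simp add: ennreal_mult' mult_ac)
  also have "\<dots> \<le> ennreal a * (2 * (\<integral>\<^sup>+ h. ennreal (w h) * indicator S h \<partial>lborel))"
    by (intro mult_left_mono N_le) auto
  also have "\<dots> = ennreal (2 * a) * (\<integral>\<^sup>+ h. ennreal (w h) * indicator S h \<partial>lborel)"
    using a by (simp add: ennreal_mult' mult_ac)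
  also have "\<dots> \<le> 2 * ?I"
    by (rule S_le)
  finally have "ennreal (N * a) * middle (4 / norm \<xi>) \<le> 2 * ?I" .
  moreover have "N * a = real DIM('a) * unit_ball_vol DIM('a) * c / (2 powr \<gamma> * 2 ^ DIM('a))"
    by (simp add: N_def a_def n_def)
  ultimately show ?thesis
    by (simp only: w_def n_def)
qed

text \<open>Both one-sided bounds carry errors independent of \<open>\<xi>\<close>: the mass of the
  jumps beyond \<open>\<rho>\<close> and \<open>tail (\<rho> / 2)\<close>. Divergence at
  \<open>0\<close> makes \<open>tail (1 / norm \<xi>)\<close> exceed any such constant for large
  \<open>norm \<xi>\<close>, which absorbs them.\<close>

lemma oscillation_comparable_tail:
  fixes k :: "'a::euclidean_space \<Rightarrow> real"
  assumes [measurable]: "k \<in> borel_measurable borel" and k: "\<And>h. 0 \<le> k h"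
    and \<kappa>: "0 < \<kappa>"
    and k_le: "\<And>h. h \<noteq> 0 \<Longrightarrow> ereal (norm h) < R \<Longrightarrow> k h \<le> \<kappa> * (f (norm h) / norm h ^ DIM('a))"
    and k_ge: "\<And>h. h \<noteq> 0 \<Longrightarrow> ereal (norm h) < R \<Longrightarrow> f (norm h) / norm h ^ DIM('a) \<le> \<kappa> * k h"
    and \<rho>: "0 < \<rho>" "ereal \<rho> < R"
    and D: "(\<integral>\<^sup>+ h. ennreal (k h) * indicator {\<rho>..} (norm h) \<partial>lborel) \<le> ennreal D"
    and divergent: "(\<integral>\<^sup>+ s. ennreal (f s / s) \<partial>lborel) = \<infinity>"
    and tail_finite: "\<And>r. 0 < r \<Longrightarrow> ereal r < R \<Longrightarrow> tail r < \<infinity>"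
  shows "\<exists>C>0. \<exists>r\<^sub>0>0. \<forall>\<xi>. r\<^sub>0 \<le> norm \<xi> \<longrightarrow> ereal (1 / norm \<xi>) < R \<and>
    tail (1 / norm \<xi>) \<le> ennreal C * (\<integral>\<^sup>+ h. ennreal ((1 - cos (\<xi> \<bullet> h)) * k h) \<partial>lborel) \<and>
    (\<integral>\<^sup>+ h. ennreal ((1 - cos (\<xi> \<bullet> h)) * k h) \<partial>lborel) \<le> ennreal C * tail (1 / norm \<xi>)"
proof -
  define a where "a = real DIM('a) * unit_ball_vol DIM('a) * c / (2 powr \<gamma> * 2 ^ DIM('a))"
  define b where "b = 6 * 8 powr \<gamma> / c\<^sup>2 + 1"
  define C\<^sub>1 where "C\<^sub>1 = real DIM('a) * unit_ball_vol DIM('a) *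
    (2 powr \<gamma> * \<kappa> / (c\<^sup>2 * (2 - \<gamma>)) + 2 * \<kappa>)"
  \<comment> \<open>One constant for both directions: the upper bound asks for
    \<open>C\<^sub>1 + 2 * \<bar>D\<bar>\<close>, the lower one for
    \<open>4 * b * \<kappa> / a\<close>, and \<open>1\<close> keeps it positive. The absolute value
    is there because the sign of \<open>D\<close> is open.\<close>
  define C where "C = C\<^sub>1 + 2 * \<bar>D\<bar> + 4 * b * \<kappa> / a + 1"
  have a: "a > 0"
    using c by (simp add: a_def)
  have b: "b > 0"
    by (simp add: b_def add_nonneg_pos)
  have C\<^sub>1: "C\<^sub>1 \<ge> 0"
    using \<kappa> \<gamma> by (simp add: C\<^sub>1_def)
  have C: "C > 0" "4 * b * \<kappa> / a \<le> C" "C\<^sub>1 + 2 * \<bar>D\<bar> \<le> C"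
    using a b \<kappa> C\<^sub>1 by (auto simp: C_def intro!: add_nonneg_pos add_nonneg_nonneg)
  have half: "ereal (\<rho> / 2) < R"
    using \<rho> by (auto intro: le_less_trans[of _ "ereal \<rho>"])
  have fin: "tail (\<rho> / 2) < \<infinity>"
    using \<rho> half by (intro tail_finite) auto
  \<comment> \<open>Exceeding \<open>1\<close> absorbs the mass of the large jumps, exceeding
    \<open>2 * tail (\<rho> / 2)\<close> the scales near \<open>R\<close>.\<close>
  then have "max 1 (2 * tail (\<rho> / 2)) < \<infinity>"
    by (simp add: ennreal_mult_less_top)
  from tail_unbounded[OF divergent this] obtain r\<^sub>1 where r\<^sub>1: "r\<^sub>1 > 0"
    and large: "\<And>r. 0 < r \<Longrightarrow> r \<le> r\<^sub>1 \<Longrightarrow> max 1 (2 * tail (\<rho> / 2)) < tail r"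
    by blast
  \<comment> \<open>The first entry gives \<open>r \<le> r\<^sub>1\<close>, the second
    \<open>32 * r \<le> \<rho>\<close>, which puts the multiples \<open>2 * r\<close> and
    \<open>16 * r\<close> used by the estimates below \<open>R\<close>.\<close>
  define r\<^sub>0 where "r\<^sub>0 = max (1 / r\<^sub>1) (32 / \<rho>)"
  have "r\<^sub>0 > 0"
    using r\<^sub>1 by (simp add: r\<^sub>0_def less_max_iff_disj)
  moreover have "ereal (1 / norm \<xi>) < R \<and>
    tail (1 / norm \<xi>) \<le> ennreal C * (\<integral>\<^sup>+ h. ennreal ((1 - cos (\<xi> \<bullet> h)) * k h) \<partial>lborel) \<and>
    (\<integral>\<^sup>+ h. ennreal ((1 - cos (\<xi> \<bullet> h)) * k h) \<partial>lborel) \<le> ennreal C * tail (1 / norm \<xi>)"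
    if \<xi>: "r\<^sub>0 \<le> norm \<xi>" for \<xi>
  proof -
    define r where "r = 1 / norm \<xi>"
    define E where "E = (\<integral>\<^sup>+ h. ennreal ((1 - cos (\<xi> \<bullet> h)) * k h) \<partial>lborel)"
    have \<xi>_pos: "0 < norm \<xi>"
      using \<open>r\<^sub>0 > 0\<close> \<xi> by linarith
    then have r: "0 < r"
      by (simp add: r_def)
    have "1 / r\<^sub>1 \<le> norm \<xi>" "32 / \<rho> \<le> norm \<xi>"
      using \<xi> by (auto simp: r\<^sub>0_def)
    then have "r \<le> r\<^sub>1" "32 * r \<le> \<rho>"
      using \<xi>_pos r\<^sub>1 \<rho> by (auto simp: r_def field_simps)
    have less_R: "ereal x < R" if "x \<le> 32 * r" for x
      using that \<open>32 * r \<le> \<rho>\<close> \<rho>(2) by (intro le_less_trans[of "ereal x" "ereal \<rho>"]) auto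
    have tail_gt: "1 < tail r" "2 * tail (\<rho> / 2) < tail r"
      using large[OF r \<open>r \<le> r\<^sub>1\<close>] by auto
    have tail_r: "tail r < \<infinity>"
      using r by (intro tail_finite less_R) auto
    have "E \<le> ennreal C\<^sub>1 * tail r + 2 * (\<integral>\<^sup>+ h. ennreal (k h) * indicator {\<rho>..} (norm h) \<partial>lborel)"
      unfolding E_def C\<^sub>1_def r_def using \<xi>_pos \<rho> \<kappa> k
      by (intro oscillation_le_tail k_le) (auto intro!: less_R divide_right_mono simp: r_def)
    \<comment> \<open>As \<open>tail r\<close> exceeds \<open>1\<close>, the constant error may be
      multiplied by it.\<close>
    also have "\<dots> \<le> ennreal C\<^sub>1 * tail r + (2 * ennreal \<bar>D\<bar>) * tail r"
    proof (intro add_left_mono)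
      have "(\<integral>\<^sup>+ h. ennreal (k h) * indicator {\<rho>..} (norm h) \<partial>lborel) \<le> ennreal \<bar>D\<bar>"
        by (rule order_trans[OF D]) (simp add: ennreal_leI)
      then have "2 * (\<integral>\<^sup>+ h. ennreal (k h) * indicator {\<rho>..} (norm h) \<partial>lborel) \<le> 2 * ennreal \<bar>D\<bar> * 1"
        by (simp add: mult_left_mono)
      also have "\<dots> \<le> 2 * ennreal \<bar>D\<bar> * tail r"
        using tail_gt by (intro mult_left_mono) auto
      finally show "2 * (\<integral>\<^sup>+ h. ennreal (k h) * indicator {\<rho>..} (norm h) \<partial>lborel) \<le> 2 * ennreal \<bar>D\<bar> * tail r" .
    qed
    also have "\<dots> = ennreal (C\<^sub>1 + 2 * \<bar>D\<bar>) * tail r"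
      using C\<^sub>1 by (simp add: ennreal_mult' distrib_right)
    also have "\<dots> \<le> ennreal C * tail r"
      by (intro mult_right_mono ennreal_leI C) auto
    finally have upper: "E \<le> ennreal C * tail r" .
    \<comment> \<open>The absorption below subtracts, so all quantities are first shown finite and
      replaced by real numbers.\<close>
    then have "E < \<infinity>"
      using tail_r by (auto simp: ennreal_mult_less_top intro: le_less_trans)
    then obtain e where e: "E = ennreal e" "e \<ge> 0"
      by (cases E) auto
    have "middle (4 * r) \<le> tail r"
      unfolding middle_def tail_def using r by (intro nn_integral_mono) (auto split: split_indicator)
    then obtain m where m: "middle (4 * r) = ennreal m" "m \<ge> 0"
      using tail_r by (cases "middle (4 * r)") (auto simp: top_unique)
    obtain t where t: "tail r = ennreal t" "t \<ge> 0"
      using tail_r by (cases "tail r") auto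
    obtain t' where t': "tail (\<rho> / 2) = ennreal t'" "t' \<ge> 0"
      using fin by (cases "tail (\<rho> / 2)") auto
    have "ennreal a * middle (4 * r)
        \<le> 2 * (\<integral>\<^sup>+ h. ennreal ((1 - cos (\<xi> \<bullet> h)) * (f (norm h) / norm h ^ DIM('a))) \<partial>lborel)"
      using middle_le_oscillation[of \<xi>] \<xi>_pos by (simp add: a_def r_def)
    also have "\<dots> \<le> 2 * (\<integral>\<^sup>+ h. ennreal \<kappa> * ennreal ((1 - cos (\<xi> \<bullet> h)) * k h) \<partial>lborel)"
    proof (intro mult_left_mono nn_integral_mono)
      fix h
      \<comment> \<open>The comparison extends to every \<open>h\<close>, because \<open>f\<close>
        vanishes at \<open>0\<close> and at all scales not below \<open>R\<close>.\<close>
      have le: "f (norm h) / norm h ^ DIM('a) \<le> \<kappa> * k h"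
      proof (cases "h \<noteq> 0 \<and> ereal (norm h) < R")
        case True
        then show ?thesis
          by (intro k_ge) auto
      next
        case False
        then have "f (norm h) = 0"
          by (intro f_outside) (auto simp: einterval_iff)
        then show ?thesis
          using \<kappa> k[of h] by simp
      qed
      have "(1 - cos (\<xi> \<bullet> h)) * (f (norm h) / norm h ^ DIM('a)) \<le> (1 - cos (\<xi> \<bullet> h)) * (\<kappa> * k h)"
        by (rule mult_left_mono[OF le]) simp
      also have "\<dots> = \<kappa> * ((1 - cos (\<xi> \<bullet> h)) * k h)"
        by simp
      finally show "ennreal ((1 - cos (\<xi> \<bullet> h)) * (f (norm h) / norm h ^ DIM('a)))
          \<le> ennreal \<kappa> * ennreal ((1 - cos (\<xi> \<bullet> h)) * k h)"
        using \<kappa> by (simp add: ennreal_leI flip: ennreal_mult')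
    qed simp
    also have "\<dots> = 2 * (ennreal \<kappa> * E)"
      unfolding E_def by (subst nn_integral_cmult) auto
    finally have "ennreal (a * m) \<le> ennreal (2 * (\<kappa> * e))"
      using a \<kappa> e m by (simp add: ennreal_mult')
    then have m_le: "a * m \<le> 2 * (\<kappa> * e)"
      using \<kappa> e by simp
    have "tail r \<le> ennreal b * middle (4 * r) + tail (\<rho> / 2)"
      unfolding b_def using r \<rho> by (intro tail_le_middle less_R) auto
    then have "ennreal t \<le> ennreal (b * m + t')"
      using b m t t' by (simp add: ennreal_mult')
    then have "t \<le> b * m + t'"
      using b m t' by (subst (asm) ennreal_le_iff) auto
    moreover have "2 * t' \<le> t"
    proof -
      have "ennreal (2 * t') \<le> ennreal t"
        using tail_gt(2) t t' by (simp add: ennreal_mult')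
      then show ?thesis
        using t by simp
    qed
    \<comment> \<open>The error \<open>t'\<close> is at most half of \<open>t\<close> and moves to
      the left side.\<close>
    ultimately have "t \<le> 2 * b * m"
      by simp
    also have "\<dots> \<le> 2 * b * (2 * (\<kappa> * e) / a)"
      using m_le a b by (intro mult_left_mono) (auto simp: field_simps)
    also have "\<dots> = 4 * b * \<kappa> / a * e"
      by simp
    also have "\<dots> \<le> C * e"
      using C e by (intro mult_right_mono) auto
    finally have "tail r \<le> ennreal C * E"
      using C e t by (simp add: ennreal_leI flip: ennreal_mult')
    then show ?thesis
      using upper less_R[of r] r unfolding r_def E_def by simp
  qed
  ultimately show ?thesis
    using C(1) by blast
qed

end

section \<open>The characteristic exponent of a symmetric Levy density\<close>

text \<open>The imaginary part of the integrand is the compensated sine, odd in \<open>h\<close>, so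
  by symmetry its integral vanishes. Real and imaginary parts are each dominated by a multiple of
  \<open>min 1 ((norm h)\<^sup>2)\<close>, which justifies splitting the integral. The extension
  \<open>k'\<close> by zero moves everything to the whole space.\<close>

lemma characteristic_exponent_symmetric:
  fixes k :: "'a::euclidean_space \<Rightarrow> real" and \<xi> :: 'a
  defines "k' \<equiv> (\<lambda>h. indicator (- {0}) h * k h)"
  assumes k_measurable: "k \<in> borel_measurable (restrict_space borel (- {0}))"
    and k_nonneg: "\<And>h. h \<noteq> 0 \<Longrightarrow> 0 \<le> k h"
    and k_sym: "AE h in lborel. k h = k (- h)"
    and k_levy: "(\<integral>\<^sup>+ h. ennreal (min 1 ((norm h)\<^sup>2) * k' h) \<partial>lborel) < \<infinity>"
  shows "characteristic_exponent (levy_measure k) \<xi> =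
    complex_of_real (enn2real (\<integral>\<^sup>+ h. ennreal ((1 - cos (\<xi> \<bullet> h)) * k' h) \<partial>lborel))"
proof -
  have [measurable]: "k' \<in> borel_measurable borel"
    using k_measurable unfolding k'_def by (subst (asm) borel_measurable_restrict_space_iff) auto
  have k': "0 \<le> k' h" for h
    using k_nonneg by (simp add: k'_def indicator_def)
  have k'_sym: "AE h in lborel. k' (- h) = k' h"
    using k_sym by eventually_elim (simp add: k'_def indicator_def)
  define F where "F h = 1 - exp (\<i> * complex_of_real (\<xi> \<bullet> h))
        + \<i> * complex_of_real (\<xi> \<bullet> h) * indicator (ball 0 1) h" for h :: 'a
  define u where "u h = (1 - cos (\<xi> \<bullet> h)) * k' h" for h
  define v where "v h = (indicator (ball 0 1) h * (\<xi> \<bullet> h) - sin (\<xi> \<bullet> h)) * k' h" for h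
  have [measurable]: "ball 0 1 \<in> sets (borel :: 'a measure)"
    by simp
  have [measurable]: "F \<in> borel_measurable borel"
    unfolding F_def by measurable
  have [measurable]: "u \<in> borel_measurable borel"
    unfolding u_def by measurable
  have [measurable]: "v \<in> borel_measurable borel"
    unfolding v_def by measurable
  have dominated: "integrable lborel (\<lambda>h. (2 + (norm \<xi>)\<^sup>2) * (min 1 ((norm h)\<^sup>2) * k' h))"
    using k_levy k' by (intro integrable_mult_right integrableI_nonneg) auto
  \<comment> \<open>One majorant serves both parts: a quadratic bound is demanded only for
    \<open>norm h < 1\<close>, the bound \<open>2\<close> only for \<open>norm h\<close> at least
    \<open>1\<close>.\<close>
  have bound: "x \<le> (2 + (norm \<xi>)\<^sup>2) * min 1 ((norm h)\<^sup>2)"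
    if "x \<le> (\<xi> \<bullet> h)\<^sup>2 \<or> 1 \<le> norm h" "x \<le> 2 \<or> norm h < 1" for x and h :: 'a
  proof (cases "norm h < 1")
    case True
    then have "(norm h)\<^sup>2 < 1"
      by (simp add: power_less_one_iff)
    moreover have "x \<le> (norm \<xi>)\<^sup>2 * (norm h)\<^sup>2"
      using that(1) True inner_squared_le[of \<xi> h] by linarith
    ultimately show ?thesis
      by (simp add: distrib_right add_increasing)
  next
    case False
    then have "1 \<le> (norm h)\<^sup>2"
      by simp
    then show ?thesis
      using that(2) False by (simp add: add_increasing2)
  qed
  have int_u: "integrable lborel u"
  proof (rule Bochner_Integration.integrable_bound[OF dominated _ AE_I2])
    fix h
    have "1 - cos (\<xi> \<bullet> h) \<le> (\<xi> \<bullet> h)\<^sup>2"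
      by (rule order_trans[OF one_minus_cos_le]) simp
    moreover have "1 - cos (\<xi> \<bullet> h) \<le> 2"
      using cos_ge_minus_one[of "\<xi> \<bullet> h"] by linarith
    ultimately have "(1 - cos (\<xi> \<bullet> h)) * k' h \<le> (2 + (norm \<xi>)\<^sup>2) * min 1 ((norm h)\<^sup>2) * k' h"
      using k' by (intro mult_right_mono bound) auto
    then show "norm (u h) \<le> norm ((2 + (norm \<xi>)\<^sup>2) * (min 1 ((norm h)\<^sup>2) * k' h))"
      using k'[of h] by (simp add: u_def abs_mult mult.assoc)
  qed measurable
  have int_v: "integrable lborel v"
  proof (rule Bochner_Integration.integrable_bound[OF dominated _ AE_I2])
    fix h
    \<comment> \<open>The Taylor polynomial of the sine of degree below \<open>2\<close> is
      \<open>x\<close>, which the compensator cancels inside the unit ball; the remainder is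
      quadratic.\<close>
    have "\<bar>sin x - x\<bar> \<le> x\<^sup>2 / 2" for x :: real
      using Maclaurin_sin_bound[of x 2] by (simp add: numeral_2_eq_2 sin_coeff_def)
    from this[of "\<xi> \<bullet> h"] have "\<bar>\<xi> \<bullet> h - sin (\<xi> \<bullet> h)\<bar> \<le> (\<xi> \<bullet> h)\<^sup>2"
      using zero_le_power2[of "\<xi> \<bullet> h"] by linarith
    then have "\<bar>indicator (ball 0 1) h * (\<xi> \<bullet> h) - sin (\<xi> \<bullet> h)\<bar> \<le> (2 + (norm \<xi>)\<^sup>2) * min 1 ((norm h)\<^sup>2)"
      by (intro bound) (auto simp: indicator_def intro: order_trans[OF abs_sin_le_one])
    then have "\<bar>indicator (ball 0 1) h * (\<xi> \<bullet> h) - sin (\<xi> \<bullet> h)\<bar> * k' h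
        \<le> (2 + (norm \<xi>)\<^sup>2) * min 1 ((norm h)\<^sup>2) * k' h"
      using k' by (intro mult_right_mono)
    then show "norm (v h) \<le> norm ((2 + (norm \<xi>)\<^sup>2) * (min 1 ((norm h)\<^sup>2) * k' h))"
      using k'[of h] by (simp add: v_def abs_mult mult.assoc)
  qed measurable
  have "characteristic_exponent (levy_measure k) \<xi> = (\<integral> h. k h *\<^sub>R F h \<partial>restrict_space lborel (- {0}))"
    unfolding characteristic_exponent_def levy_measure_def F_def[symmetric]
  proof (rule integral_density)
    show "F \<in> borel_measurable (restrict_space lborel (- {0}))"
      by (rule measurable_restrict_space1) simp
    show "k \<in> borel_measurable (restrict_space lborel (- {0}))"
      using k_measurable by (simp cong: measurable_cong_sets restrict_space_sets_cong)
    show "AE h in restrict_space lborel (- {0}). 0 \<le> k h"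
      by (rule AE_I2) (simp add: space_restrict_space k_nonneg)
  qed
  also have "\<dots> = (\<integral> h. indicator (- {0}) h *\<^sub>R k h *\<^sub>R F h \<partial>lborel)"
    by (rule integral_restrict_space) simp
  also have "(\<lambda>h. indicator (- {0}) h *\<^sub>R k h *\<^sub>R F h) = (\<lambda>h. complex_of_real (u h) + \<i> * complex_of_real (v h))"
    by (rule ext) (auto simp: F_def u_def v_def k'_def complex_eq_iff Re_exp Im_exp indicator_def)
  also have "(\<integral> h. complex_of_real (u h) + \<i> * complex_of_real (v h) \<partial>lborel)
      = complex_of_real (\<integral> h. u h \<partial>lborel) + \<i> * complex_of_real (\<integral> h. v h \<partial>lborel)"
    using int_u int_v by simp
  also have "(\<integral> h. v h \<partial>lborel) = 0"
  proof -
    have "(\<integral> h. v h \<partial>lborel) = (\<integral> h. v (- h) \<partial>lborel)"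
      by (simp add: integral_lborel_uminus)
    also have "\<dots> = (\<integral> h. - v h \<partial>lborel)"
    proof (rule integral_cong_AE)
      show "AE h in lborel. v (- h) = - v h"
        using k'_sym by eventually_elim (simp add: v_def indicator_def algebra_simps)
    qed measurable
    finally show ?thesis by simp
  qed
  also have "(\<integral> h. u h \<partial>lborel) = enn2real (\<integral>\<^sup>+ h. ennreal (u h) \<partial>lborel)"
    using k' by (intro integral_eq_nn_integral) (auto simp: u_def)
  finally show ?thesis
    by (simp add: u_def)
qed

section \<open>Transfer of the comparison to \<open>\<psi>\<close> and \<open>L\<close>\<close>

theorem proposition6:
  fixes R\<^sub>0 :: ereal
    and l :: "real \<Rightarrow> real"
    and K :: "'a::euclidean_space \<Rightarrow> 'a \<Rightarrow> real"
    and k :: "'a \<Rightarrow> real"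
    and \<kappa> K\<^sub>0 c\<^sub>L c\<^sub>U \<gamma> :: real
    and \<nu> :: "'a measure"
    and A :: "('a \<Rightarrow> complex) \<Rightarrow> 'a \<Rightarrow> complex"
    and \<psi> :: "'a \<Rightarrow> complex"
    and L :: "real \<Rightarrow> real"
  assumes R0: "0 < R\<^sub>0"
    and l_measurable: "l \<in> borel_measurable (restrict_space borel (einterval 0 R\<^sub>0))"
    and l_pos: "\<And>s. s \<in> einterval 0 R\<^sub>0 \<Longrightarrow> 0 < l s"
    and l_divergent: "(\<integral>\<^sup>+ s\<in>einterval 0 R\<^sub>0. ennreal (l s / s) \<partial>lborel) = \<infinity>"
    and l_tail: "\<And>r. 0 < r \<Longrightarrow> ereal r < R\<^sub>0 \<Longrightarrow>
          (\<integral>\<^sup>+ s\<in>einterval (ereal r) R\<^sub>0. ennreal (l s / s) \<partial>lborel) < \<infinity>"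
    and constants: "0 < c\<^sub>L" "c\<^sub>L < 1" "1 \<le> c\<^sub>U" "0 < \<gamma>" "\<gamma> < 2"
    and l_lower: "\<And>r t. 0 < r \<Longrightarrow> 1 \<le> t \<Longrightarrow> ereal t < R\<^sub>0 / ereal r \<Longrightarrow>
          c\<^sub>L * t powr (- \<gamma>) \<le> l (r * t) / l r"
    and l_upper: "\<And>r t. 0 < r \<Longrightarrow> 1 \<le> t \<Longrightarrow> ereal t < R\<^sub>0 / ereal r \<Longrightarrow>
          l (r * t) / l r \<le> c\<^sub>U * t ^ DIM('a)"
    and K_measurable: "case_prod K \<in> borel_measurable (borel \<Otimes>\<^sub>M restrict_space borel (- {0}))"
    and K_nonneg: "\<And>x h. h \<noteq> 0 \<Longrightarrow> 0 \<le> K x h"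
    and K_eq: "\<And>x h. h \<noteq> 0 \<Longrightarrow> K x h = k h"
    and K_sym: "AE (x, h) in lborel \<Otimes>\<^sub>M lborel. K x h = K x (- h)"
    and kappa: "1 \<le> \<kappa>" and K0: "1 \<le> K\<^sub>0"
    and K_bounds: "\<And>x h. 0 < norm h \<Longrightarrow> ereal (norm h) < R\<^sub>0 \<Longrightarrow>
          inverse \<kappa> * (l (norm h) / norm h ^ DIM('a)) \<le> K x h \<and>
          K x h \<le> \<kappa> * (l (norm h) / norm h ^ DIM('a))"
    and K_int: "(SUP x. \<integral>\<^sup>+ h\<in>- {0}. ennreal (min 1 ((norm h)\<^sup>2) * K x h) \<partial>lborel) \<le> ennreal K\<^sub>0"
    and nu: "\<nu> = levy_measure k"
    and A: "\<And>u x. u \<in> schwartz \<Longrightarrow> A u x = levy_operator \<nu> u x"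
    and psi: "\<psi> = characteristic_exponent \<nu>"
    and L: "L = scale_integral R\<^sub>0 l"
  shows "\<exists>c>0. \<exists>r\<^sub>0>0. \<forall>\<xi>. r\<^sub>0 \<le> norm \<xi> \<longrightarrow>
          \<psi> \<xi> \<in> \<real> \<and>
          inverse c * L (inverse (norm \<xi>)) \<le> Re (\<psi> \<xi>) \<and>
          Re (\<psi> \<xi>) \<le> c * L (inverse (norm \<xi>))"
proof -
  \<comment> \<open>Extensions by zero: measurability is given for \<open>l\<close> only on the
    scales below \<open>R\<^sub>0\<close>, and for the kernel only off the origin.\<close>
  define f where "f s = (if s \<in> einterval 0 R\<^sub>0 then l s else 0)" for s
  define k' where "k' h = indicator (- {0}) h * k h" for h
  have f_eq: "f s = l s" if "0 < s" "ereal s < R\<^sub>0" for s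
    using that by (simp add: f_def einterval_iff)
  interpret lower_scaling R\<^sub>0 f c\<^sub>L \<gamma>
  proof
    have "f = (\<lambda>s. indicator (einterval 0 R\<^sub>0) s *\<^sub>R l s)"
      by (auto simp: f_def)
    then show "f \<in> borel_measurable borel"
      using l_measurable by (simp add: borel_measurable_restrict_space_iff)
    show "0 \<le> f s" for s
      using l_pos[of s] by (auto simp: f_def less_imp_le)
    show "c\<^sub>L * (t / s) powr (- \<gamma>) * f s \<le> f t" if "0 < s" "s \<le> t" "ereal t < R\<^sub>0" for s t
    proof -
      have "ereal s < R\<^sub>0"
        using that by (auto intro: le_less_trans[of _ "ereal t"])
      then have l_s: "0 < l s"
        using that by (intro l_pos) (simp add: einterval_iff)
      have "ereal (t / s) < R\<^sub>0 / ereal s"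
        using that by (subst ereal_less_divide_pos) auto
      then have "c\<^sub>L * (t / s) powr (- \<gamma>) \<le> l (s * (t / s)) / l s"
        using that by (intro l_lower) auto
      then show ?thesis
        using that l_s \<open>ereal s < R\<^sub>0\<close> by (simp add: f_eq field_simps)
    qed
  qed (use constants in \<open>auto simp: f_def\<close>)
  have k_measurable: "k \<in> borel_measurable (restrict_space borel (- {0}))"
  proof -
    have "K 0 \<in> borel_measurable (restrict_space borel (- {0}))"
      using measurable_compose[OF measurable_Pair1' K_measurable, of 0] by simp
    then show ?thesis
      by (rule measurable_cong[THEN iffD1, rotated]) (simp add: space_restrict_space K_eq)
  qed
  then have [measurable]: "k' \<in> borel_measurable borel"
    unfolding k'_def by (subst (asm) borel_measurable_restrict_space_iff) auto
  have k_nonneg: "0 \<le> k h" if "h \<noteq> 0" for h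
    using K_nonneg[OF that] K_eq[OF that] by simp
  then have k': "0 \<le> k' h" for h
    by (simp add: k'_def indicator_def)
  have k_sym: "AE h in lborel. k h = k (- h)"
  proof -
    \<comment> \<open>Almost every section of \<open>K\<close> is symmetric; the space is not a null
      set, so one such section exists, and it agrees with \<open>k\<close> off the origin.\<close>
    have "AE x in lborel. AE h in lborel. K x h = K x (- h)"
      using lborel_pair.AE_pair[OF K_sym] by simp
    then have "\<exists>x. AE h in lborel. K x h = K x (- h)"
      by (intro eventually_happens') (auto simp: ae_filter_eq_bot_iff)
    then obtain x where "AE h in lborel. K x h = K x (- h)" ..
    then show ?thesis
    proof eventually_elim
      case (elim h)
      then show ?case
        by (cases "h = 0") (auto simp: K_eq)
    qed
  qed
  have k_levy: "(\<integral>\<^sup>+ h. ennreal (min 1 ((norm h)\<^sup>2) * k' h) \<partial>lborel) \<le> ennreal K\<^sub>0"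
  proof -
    have "(\<integral>\<^sup>+ h. ennreal (min 1 ((norm h)\<^sup>2) * k' h) \<partial>lborel)
        = (\<integral>\<^sup>+ h\<in>- {0}. ennreal (min 1 ((norm h)\<^sup>2) * K 0 h) \<partial>lborel)"
      by (intro nn_integral_cong) (auto simp: k'_def K_eq indicator_def)
    also have "\<dots> \<le> (SUP x. \<integral>\<^sup>+ h\<in>- {0}. ennreal (min 1 ((norm h)\<^sup>2) * K x h) \<partial>lborel)"
      by (rule SUP_upper) simp
    finally show ?thesis
      using K_int by simp
  qed
  \<comment> \<open>A finite radius is chosen even when \<open>R\<^sub>0\<close> is infinite; being
    below \<open>1\<close> it satisfies \<open>\<rho>\<^sup>2 \<le> min 1 ((norm h)\<^sup>2)\<close>
    whenever \<open>\<rho> \<le> norm h\<close>, as the Chebyshev bound that follows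
    requires.\<close>
  have "(0::ereal) < min 1 R\<^sub>0"
    using R0 by simp
  from ereal_dense2[OF this] obtain \<rho> where "0 < ereal \<rho>" "ereal \<rho> < min 1 R\<^sub>0"
    by blast
  then have \<rho>: "0 < \<rho>" "\<rho> < 1" "ereal \<rho> < R\<^sub>0"
    by simp_all
  have far: "(\<integral>\<^sup>+ h. ennreal (k' h) * indicator {\<rho>..} (norm h) \<partial>lborel) \<le> ennreal (K\<^sub>0 / \<rho>\<^sup>2)"
  proof -
    have "(\<integral>\<^sup>+ h. ennreal (k' h) * indicator {\<rho>..} (norm h) \<partial>lborel)
        \<le> (\<integral>\<^sup>+ h. ennreal (1 / \<rho>\<^sup>2) * ennreal (min 1 ((norm h)\<^sup>2) * k' h) \<partial>lborel)"
    proof (rule nn_integral_mono)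
      fix h :: 'a
      have "k' h \<le> 1 / \<rho>\<^sup>2 * (min 1 ((norm h)\<^sup>2) * k' h)" if "\<rho> \<le> norm h"
      proof -
        have "\<rho>\<^sup>2 \<le> min 1 ((norm h)\<^sup>2)"
          using \<rho> that by (simp add: power_le_one power_mono)
        then have "\<rho>\<^sup>2 * k' h \<le> min 1 ((norm h)\<^sup>2) * k' h"
          using k' by (rule mult_right_mono)
        then show ?thesis
          using \<rho> by (simp add: field_simps)
      qed
      then show "ennreal (k' h) * indicator {\<rho>..} (norm h)
          \<le> ennreal (1 / \<rho>\<^sup>2) * ennreal (min 1 ((norm h)\<^sup>2) * k' h)"
        by (auto simp: ennreal_leI simp flip: ennreal_mult' split: split_indicator)
    qed
    also have "\<dots> = ennreal (1 / \<rho>\<^sup>2) * (\<integral>\<^sup>+ h. ennreal (min 1 ((norm h)\<^sup>2) * k' h) \<partial>lborel)"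
      by (rule nn_integral_cmult) measurable
    also have "\<dots> \<le> ennreal (1 / \<rho>\<^sup>2) * ennreal K\<^sub>0"
      by (intro mult_left_mono k_levy) simp
    also have "\<dots> = ennreal (K\<^sub>0 / \<rho>\<^sup>2)"
      by (simp flip: ennreal_mult')
    finally show ?thesis .
  qed
  have tail_eq: "tail r = (\<integral>\<^sup>+ s\<in>einterval (ereal r) R\<^sub>0. ennreal (l s / s) \<partial>lborel)" if "0 < r" for r
    unfolding tail_def
  proof (rule nn_integral_cong_AE)
    show "AE s in lborel. ennreal (f s / s) * indicator {r..} s
        = ennreal (l s / s) * indicator (einterval (ereal r) R\<^sub>0) s"
      using AE_lborel_singleton[of r]
      by eventually_elim (use that in \<open>auto simp: f_def einterval_iff indicator_def\<close>)
  qed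
  \<comment> \<open>\<open>L\<close> is a Bochner integral of a nonnegative function near which
    \<open>enn2real\<close> uses the same convention: both give \<open>0\<close> if the integral
    diverges.\<close>
  have L_eq: "L r = enn2real (tail r)" if "0 < r" for r
  proof -
    have "L r = (\<integral> s. indicator (einterval (ereal r) R\<^sub>0) s * (f s / s) \<partial>lborel)"
      unfolding L scale_integral_def set_lebesgue_integral_def
      using that by (intro Bochner_Integration.integral_cong) (auto simp: f_def einterval_iff indicator_def)
    also have "\<dots> = enn2real (\<integral>\<^sup>+ s. ennreal (indicator (einterval (ereal r) R\<^sub>0) s * (f s / s)) \<partial>lborel)"
      using that f_nonneg
      by (intro integral_eq_nn_integral) (auto simp: einterval_iff indicator_def)
    also have "(\<integral>\<^sup>+ s. ennreal (indicator (einterval (ereal r) R\<^sub>0) s * (f s / s)) \<partial>lborel) = tail r"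
      unfolding tail_eq[OF that]
      using that by (intro nn_integral_cong) (auto simp: f_def einterval_iff indicator_def)
    finally show ?thesis .
  qed
  have f_divergent: "(\<integral>\<^sup>+ s. ennreal (f s / s) \<partial>lborel) = \<infinity>"
    unfolding l_divergent[symmetric]
    by (intro nn_integral_cong) (auto simp: f_def indicator_def)
  have tail_finite: "tail r < \<infinity>" if "0 < r" "ereal r < R\<^sub>0" for r
    using l_tail[OF that] tail_eq that by simp
  have "\<exists>C>0. \<exists>r\<^sub>0>0. \<forall>\<xi>. r\<^sub>0 \<le> norm \<xi> \<longrightarrow> ereal (1 / norm \<xi>) < R\<^sub>0 \<and>
    tail (1 / norm \<xi>) \<le> ennreal C * (\<integral>\<^sup>+ h. ennreal ((1 - cos (\<xi> \<bullet> h)) * k' h) \<partial>lborel) \<and>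
    (\<integral>\<^sup>+ h. ennreal ((1 - cos (\<xi> \<bullet> h)) * k' h) \<partial>lborel) \<le> ennreal C * tail (1 / norm \<xi>)"
  proof (rule oscillation_comparable_tail[where \<kappa> = \<kappa>, OF _ k' _ _ _ \<rho>(1,3) far f_divergent tail_finite])
    fix h :: 'a
    assume h: "h \<noteq> 0" "ereal (norm h) < R\<^sub>0"
    have ge: "inverse \<kappa> * (f (norm h) / norm h ^ DIM('a)) \<le> k' h"
      and le: "k' h \<le> \<kappa> * (f (norm h) / norm h ^ DIM('a))"
      using K_bounds[of h 0] h by (auto simp: K_eq k'_def f_eq)
    show "f (norm h) / norm h ^ DIM('a) \<le> \<kappa> * k' h"
      using mult_left_mono[OF ge, of \<kappa>] kappa by (simp flip: mult.assoc)
    show "k' h \<le> \<kappa> * (f (norm h) / norm h ^ DIM('a))"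
      by (rule le)
  qed (use kappa in auto)
  then obtain C r\<^sub>0 where C: "C > 0" "r\<^sub>0 > 0"
    and comparable: "\<And>\<xi>. r\<^sub>0 \<le> norm \<xi> \<Longrightarrow> ereal (1 / norm \<xi>) < R\<^sub>0 \<and>
    tail (1 / norm \<xi>) \<le> ennreal C * (\<integral>\<^sup>+ h. ennreal ((1 - cos (\<xi> \<bullet> h)) * k' h) \<partial>lborel) \<and>
    (\<integral>\<^sup>+ h. ennreal ((1 - cos (\<xi> \<bullet> h)) * k' h) \<partial>lborel) \<le> ennreal C * tail (1 / norm \<xi>)"
    by blast
  have "\<psi> \<xi> \<in> \<real> \<and> inverse C * L (inverse (norm \<xi>)) \<le> Re (\<psi> \<xi>) \<and>
      Re (\<psi> \<xi>) \<le> C * L (inverse (norm \<xi>))" if \<xi>: "r\<^sub>0 \<le> norm \<xi>" for \<xi>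
  proof -
    define E where "E = (\<integral>\<^sup>+ h. ennreal ((1 - cos (\<xi> \<bullet> h)) * k' h) \<partial>lborel)"
    have "0 < norm \<xi>"
      using C(2) \<xi> by linarith
    then have pos: "0 < inverse (norm \<xi>)"
      by simp
    have \<psi>_eq: "\<psi> \<xi> = complex_of_real (enn2real E)"
      unfolding psi nu E_def k'_def
      by (rule characteristic_exponent_symmetric[OF k_measurable k_nonneg k_sym])
         (use k_levy in \<open>auto simp: k'_def intro: le_less_trans\<close>)
    \<comment> \<open>Finiteness of the tail, and then of \<open>E\<close>, guarantees that
      \<open>enn2real\<close> returns their true values.\<close>
    have tail_top: "tail (inverse (norm \<xi>)) < \<infinity>"
      using comparable[OF \<xi>] pos by (intro tail_finite) (auto simp: inverse_eq_divide)
    have lower: "tail (inverse (norm \<xi>)) \<le> ennreal C * E"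
      and upper: "E \<le> ennreal C * tail (inverse (norm \<xi>))"
      using comparable[OF \<xi>] by (auto simp: E_def inverse_eq_divide)
    have "E < \<infinity>"
      using upper tail_top by (auto simp: ennreal_mult_less_top intro: le_less_trans)
    then obtain e where e: "E = ennreal e" "e \<ge> 0"
      by (cases E) auto
    obtain t where t: "tail (inverse (norm \<xi>)) = ennreal t" "t \<ge> 0"
      using tail_top by (cases "tail (inverse (norm \<xi>))") auto
    have "t \<le> C * e" "e \<le> C * t"
      using lower upper e t C by (simp_all flip: ennreal_mult')
    then show ?thesis
      unfolding \<psi>_eq L_eq[OF pos] using e t C by (simp add: field_simps)
  qed
  then show ?thesis
    using C by blast
qed

end
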